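(* There is no symmetrical antitree $\mathcal{AT}((a_k)_{1\le k\le 6})$ with $a_1=1$ and diameter $5$ that is Bonnet-Myers sharp. That is, for no positive integers $b,c$ is the antitree $\mathcal{AT}(1,b,c,c,b,1)$ Bonnet-Myers sharp.
   Context: For a sequence of positive integers $(a_k)_{1\le k\le N}$, the antitree $\mathcal{AT}((a_k))$ has vertex set the disjoint union $V_1\cup\cdots\cup V_N$ with $|V_k|=a_k$; any two distinct vertices in the same $V_k$ are adjacent, every vertex of $V_k$ is adjacent to every vertex of $V_{k+1}$, and there are no other edges; its diameter is $N-1$. It is symmetrical if $a_k=a_{N+1-k}$ for all $k$. Graphs are finite and simple; $d(x,y)$ is graph distance, $d_x$ the degree. For $p\in[0,1]$ let $\mu_x^p(z)=p$ if $z=x$, $\frac{1-p}{d_x}$ if $z\sim x$, $0$ otherwise. $W_1(\mu_1,\mu_2)=\inf_\pi\sum_{x,y}d(x,y)\pi(x,y)$ over couplings $\pi$ of $\mu_1,\mu_2$. For an edge $x\sim y$, $\kappa_p(x,y)=1-W_1(\mu_x^p,\mu_y^p)$ and $\kappa_{LLY}(x,y)=\lim_{p\to1}\kappa_p(x,y)/(1-p)$. A graph $G$ is Bonnet-Myers sharp if $\inf_{x\sim y}\kappa_{LLY}(x,y)=2/\operatorname{diam}(G)$. *)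

theory Defs
  imports "HOL-Analysis.Analysis" "Graph_Theory.Graph_Theory"
begin

(* A finite simple graph is a symmetric loop-free finite digraph (locale graph of the
   library), every undirected edge being represented by its two orientations; out_degree is
   then the degree. *)

(* Graph distance: the library's shortest-path weight with unit weight on every arc. It takes
   the value infinity in ereal for unreachable pairs, which real_of_ereal sends to 0, so the
   following notions are meaningful for connected graphs only. *)
definition gdist :: "('a, 'b) pre_digraph \<Rightarrow> 'a \<Rightarrow> 'a \<Rightarrow> real" where
  "gdist G u v = real_of_ereal (wf_digraph.\<mu> G (\<lambda>_. 1) u v)"

definition diam :: "('a, 'b) pre_digraph \<Rightarrow> real" where
  "diam G = Max ((\<lambda>(u, v). gdist G u v) ` (verts G \<times> verts G))"

definition lazy_walk :: "('a, 'b) pre_digraph \<Rightarrow> real \<Rightarrow> 'a \<Rightarrow> 'a \<Rightarrow> real" where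
  "lazy_walk G p x z =
     (if z = x then p
      else if x \<rightarrow>\<^bsub>G\<^esub> z then (1 - p) / real (out_degree G x)
      else 0)"

definition couplings ::
    "('a, 'b) pre_digraph \<Rightarrow> ('a \<Rightarrow> real) \<Rightarrow> ('a \<Rightarrow> real) \<Rightarrow> ('a \<Rightarrow> 'a \<Rightarrow> real) set" where
  "couplings G \<mu>1 \<mu>2 = {\<pi>.
     (\<forall>x\<in>verts G. \<forall>y\<in>verts G. 0 \<le> \<pi> x y) \<and>
     (\<forall>x\<in>verts G. (\<Sum>y\<in>verts G. \<pi> x y) = \<mu>1 x) \<and>
     (\<forall>y\<in>verts G. (\<Sum>x\<in>verts G. \<pi> x y) = \<mu>2 y)}"

definition W1 :: "('a, 'b) pre_digraph \<Rightarrow> ('a \<Rightarrow> real) \<Rightarrow> ('a \<Rightarrow> real) \<Rightarrow> real" where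
  "W1 G \<mu>1 \<mu>2 =
     (INF \<pi>\<in>couplings G \<mu>1 \<mu>2. \<Sum>x\<in>verts G. \<Sum>y\<in>verts G. gdist G x y * \<pi> x y)"

definition ollivier_curvature :: "('a, 'b) pre_digraph \<Rightarrow> real \<Rightarrow> 'a \<Rightarrow> 'a \<Rightarrow> real" where
  "ollivier_curvature G p x y = 1 - W1 G (lazy_walk G p x) (lazy_walk G p y)"

(* The idleness p ranges over [0,1], hence the one-sided limit. *)
definition lly_curvature :: "('a, 'b) pre_digraph \<Rightarrow> 'a \<Rightarrow> 'a \<Rightarrow> real" where
  "lly_curvature G x y = Lim (at_left 1) (\<lambda>p. ollivier_curvature G p x y / (1 - p))"

definition bonnet_myers_sharp :: "('a, 'b) pre_digraph \<Rightarrow> bool" where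
  "bonnet_myers_sharp G \<longleftrightarrow>
     (INF (x, y)\<in>arcs_ends G. lly_curvature G x y) = 2 / diam G"

(* The sequence is a list indexed from 0: the vertex (k, i) with i < as ! k is the i-th element
   of the layer of size as ! k. *)
definition antitree_verts :: "nat list \<Rightarrow> (nat \<times> nat) set" where
  "antitree_verts as = {(k, i). k < length as \<and> i < as ! k}"

definition antitree :: "nat list \<Rightarrow> (nat \<times> nat, (nat \<times> nat) \<times> (nat \<times> nat)) pre_digraph" where
  "antitree as = with_proj
     \<lparr> pverts = antitree_verts as,
       parcs = {(u, v). u \<in> antitree_verts as \<and> v \<in> antitree_verts as \<and> u \<noteq> v \<and>
                  (fst u = fst v \<or> fst v = Suc (fst u) \<or> fst u = Suc (fst v))} \<rparr>"

definition symmetrical :: "nat list \<Rightarrow> bool" where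
  "symmetrical as \<longleftrightarrow> (\<forall>k < length as. as ! k = as ! (length as - 1 - k))"

lemma finite_antitree_verts: "finite (antitree_verts as)"
proof -
  have "antitree_verts as = (SIGMA k:{..<length as}. {..<as ! k})"
    by (auto simp: antitree_verts_def)
  then show ?thesis by simp
qed

lemma graph_antitree: "graph (antitree as)"
proof -
  have "finite {(u, v). u \<in> antitree_verts as \<and> v \<in> antitree_verts as \<and> u \<noteq> v \<and>
                  (fst u = fst v \<or> fst v = Suc (fst u) \<or> fst u = Suc (fst v))}"
    by (rule finite_subset[of _ "antitree_verts as \<times> antitree_verts as"])
       (auto simp: finite_antitree_verts)
  then show ?thesis
    by unfold_locales
       (auto simp: antitree_def finite_antitree_verts symmetric_def arcs_ends_def
         arc_to_ends_def intro!: symI)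
qed

end

theory Submission
  imports Defs
begin

(* The level function is 1-Lipschitz, so by (weak) Kantorovich duality it bounds the curvature of
   every edge between consecutive layers from above, and these bounds telescope to at most 2 along
   a geodesic from the first to the last layer. If the curvature is at least 2/5 everywhere, then
   each bound equals 2/5; for the middle edge this reads 3c = 6b - 1, impossible modulo 3. *)

section \<open>Distance\<close>

lemma (in wf_digraph) gdist_nonneg: "0 \<le> gdist G u v"
proof -
  have "0 \<le> \<mu> (\<lambda>_. 1) u v"
    unfolding \<mu>_def by (intro INF_greatest) (auto intro: pos_cost_pos_awalk_cost)
  then show ?thesis
    by (simp add: gdist_def real_of_ereal_pos)
qed

lemma (in wf_digraph) awalk_cost_unit: "awalk_cost (\<lambda>_. 1) p = real (length p)"
  by (induction p) auto

text \<open>Reachability makes the infimum over walks finite, so the conversion to a real number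
  loses nothing; the default value 0 is excluded.\<close>

lemma (in wf_digraph) ereal_gdist:
  assumes "u \<rightarrow>\<^sup>*\<^bsub>G\<^esub> v"
  shows "ereal (gdist G u v) = \<mu> (\<lambda>_. 1) u v"
proof -
  obtain p where "awalk u p v"
    using assms by (auto simp: reachable_awalk)
  then have "\<mu> (\<lambda>_. 1) u v \<le> ereal (real (length p))"
    using min_cost_le_walk_cost[of u p v "\<lambda>_. 1"] by (simp add: awalk_cost_unit)
  moreover have "0 \<le> \<mu> (\<lambda>_. 1) u v"
    unfolding \<mu>_def by (intro INF_greatest) (auto simp: awalk_cost_unit)
  ultimately show ?thesis
    unfolding gdist_def by (cases "\<mu> (\<lambda>_. 1) u v") auto
qed

lemma (in wf_digraph) gdist_le_length:
  assumes "awalk u p v"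
  shows "gdist G u v \<le> real (length p)"
proof -
  have "u \<rightarrow>\<^sup>*\<^bsub>G\<^esub> v"
    using assms by (auto simp: reachable_awalk)
  from ereal_gdist[OF this] have "ereal (gdist G u v) \<le> ereal (real (length p))"
    using min_cost_le_walk_cost[OF assms, of "\<lambda>_. 1"] by (simp add: awalk_cost_unit)
  then show ?thesis by simp
qed

lemma (in wf_digraph) gdist_le_1:
  assumes "u \<rightarrow>\<^bsub>G\<^esub> v"
  shows "gdist G u v \<le> 1"
proof -
  obtain e where "awalk u [e] v"
    using assms by (auto simp: arcs_ends_conv intro: arc_implies_awalk)
  from gdist_le_length[OF this] show ?thesis by simp
qed

text \<open>The increments of \<open>f\<close> along the arcs of the walk telescope, and each is at
  most 1.\<close>

lemma (in wf_digraph) awalk_lipschitz: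
  fixes f :: "'a \<Rightarrow> real"
  assumes "\<And>x y. x \<rightarrow>\<^bsub>G\<^esub> y \<Longrightarrow> f y - f x \<le> 1" and "awalk u p v"
  shows "f v - f u \<le> real (length p)"
  using assms(2)
proof (induction p arbitrary: u)
  case Nil
  then show ?case by (auto simp: awalk_Nil_iff)
next
  case (Cons e p)
  then have "e \<in> arcs G" "u = tail G e" "awalk (head G e) p v"
    by (auto simp: awalk_Cons_iff)
  with Cons.IH[of "head G e"] assms(1)[of u "head G e"] show ?case
    by (auto dest: in_arcs_imp_in_arcs_ends)
qed

text \<open>The bound holds for every walk, hence for the infimum of their lengths. Reachability
  matters here: an unreachable pair has \<open>gdist\<close> equal to 0.\<close>

lemma (in wf_digraph) gdist_lipschitz:
  fixes f :: "'a \<Rightarrow> real"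
  assumes "\<And>x y. x \<rightarrow>\<^bsub>G\<^esub> y \<Longrightarrow> f y - f x \<le> 1" and "u \<rightarrow>\<^sup>*\<^bsub>G\<^esub> v"
  shows "f v - f u \<le> gdist G u v"
proof -
  have "ereal (f v - f u) \<le> \<mu> (\<lambda>_. 1) u v"
    unfolding \<mu>_def using awalk_lipschitz[OF assms(1)]
    by (intro INF_greatest) (auto simp: awalk_cost_unit)
  then show ?thesis
    using ereal_gdist[OF assms(2)] by (metis ereal_less_eq(3))
qed

section \<open>Transport cost\<close>

text \<open>This is the lower bound that makes the real infimum in \<open>W1\<close> a genuine
  one.\<close>

lemma (in wf_digraph) transport_cost_nonneg:
  assumes "\<pi> \<in> couplings G \<mu>1 \<mu>2"
  shows "0 \<le> (\<Sum>x\<in>verts G. \<Sum>y\<in>verts G. gdist G x y * \<pi> x y)"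
  using assms by (auto simp: couplings_def intro!: sum_nonneg mult_nonneg_nonneg gdist_nonneg)

lemma (in wf_digraph) W1_le:
  assumes "\<pi> \<in> couplings G \<mu>1 \<mu>2"
  shows "W1 G \<mu>1 \<mu>2 \<le> (\<Sum>x\<in>verts G. \<Sum>y\<in>verts G. gdist G x y * \<pi> x y)"
  unfolding W1_def
  by (intro cINF_lower assms bdd_belowI2[where m = 0] transport_cost_nonneg)

text \<open>The product coupling always exists. Nonemptiness is what allows lower bounds on the real
  infimum in \<open>W1\<close>.\<close>

lemma (in wf_digraph) couplings_nonempty:
  assumes "\<And>z. 0 \<le> \<mu>1 z" "\<And>z. 0 \<le> \<mu>2 z" "sum \<mu>1 (verts G) = 1" "sum \<mu>2 (verts G) = 1"
  shows "couplings G \<mu>1 \<mu>2 \<noteq> {}"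
proof -
  have "(\<lambda>x y. \<mu>1 x * \<mu>2 y) \<in> couplings G \<mu>1 \<mu>2"
    using assms by (auto simp: couplings_def simp flip: sum_distrib_left sum_distrib_right)
  then show ?thesis by blast
qed

text \<open>Weak Kantorovich duality: the marginal conditions turn both expectations into double
  sums against the same coupling, whose difference is bounded termwise by the cost.\<close>

lemma (in wf_digraph) W1_ge_lipschitz:
  fixes f :: "'a \<Rightarrow> real"
  assumes lip: "\<And>u v. u \<in> verts G \<Longrightarrow> v \<in> verts G \<Longrightarrow> f v - f u \<le> gdist G u v"
    and ne: "couplings G \<mu>1 \<mu>2 \<noteq> {}"
  shows "(\<Sum>z\<in>verts G. f z * \<mu>2 z) - (\<Sum>z\<in>verts G. f z * \<mu>1 z) \<le> W1 G \<mu>1 \<mu>2"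
  unfolding W1_def
proof (rule cINF_greatest[OF ne])
  fix \<pi> assume \<pi>: "\<pi> \<in> couplings G \<mu>1 \<mu>2"
  have "(\<Sum>y\<in>verts G. f y * \<mu>2 y) = (\<Sum>y\<in>verts G. \<Sum>x\<in>verts G. f y * \<pi> x y)"
    using \<pi> by (intro sum.cong) (auto simp: couplings_def simp flip: sum_distrib_left)
  also have "\<dots> = (\<Sum>x\<in>verts G. \<Sum>y\<in>verts G. f y * \<pi> x y)"
    by (rule sum.swap)
  finally have 2: "(\<Sum>y\<in>verts G. f y * \<mu>2 y) = (\<Sum>x\<in>verts G. \<Sum>y\<in>verts G. f y * \<pi> x y)" .
  have 1: "(\<Sum>x\<in>verts G. f x * \<mu>1 x) = (\<Sum>x\<in>verts G. \<Sum>y\<in>verts G. f x * \<pi> x y)"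
    using \<pi> by (intro sum.cong) (auto simp: couplings_def simp flip: sum_distrib_left)
  have "(\<Sum>y\<in>verts G. f y * \<mu>2 y) - (\<Sum>x\<in>verts G. f x * \<mu>1 x)
      = (\<Sum>x\<in>verts G. \<Sum>y\<in>verts G. (f y - f x) * \<pi> x y)"
    unfolding 1 2 by (simp add: left_diff_distrib sum_subtractf)
  also have "\<dots> \<le> (\<Sum>x\<in>verts G. \<Sum>y\<in>verts G. gdist G x y * \<pi> x y)"
    using \<pi> by (intro sum_mono mult_right_mono lip) (auto simp: couplings_def)
  finally show "(\<Sum>y\<in>verts G. f y * \<mu>2 y) - (\<Sum>x\<in>verts G. f x * \<mu>1 x)
      \<le> (\<Sum>x\<in>verts G. \<Sum>y\<in>verts G. gdist G x y * \<pi> x y)" .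
qed

section \<open>Curvature\<close>

lemma (in digraph) card_out_neighbours: "card {z. x \<rightarrow>\<^bsub>G\<^esub> z} = out_degree G x"
proof -
  have "bij_betw (head G) (out_arcs G x) {z. x \<rightarrow>\<^bsub>G\<^esub> z}"
    unfolding bij_betw_def
  proof
    show "inj_on (head G) (out_arcs G x)"
      by (intro inj_onI no_multi_arcs) (auto simp: arc_to_ends_def)
    show "head G ` out_arcs G x = {z. x \<rightarrow>\<^bsub>G\<^esub> z}"
      by (auto simp: arcs_ends_conv image_iff)
  qed
  then show ?thesis
    unfolding out_degree_def by (metis bij_betw_same_card)
qed

lemma (in digraph) out_neighbours_verts: "{z. x \<rightarrow>\<^bsub>G\<^esub> z} \<subseteq> verts G"
  by (auto simp: arcs_ends_conv)

lemma (in digraph) out_degree_pos: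
  assumes "x \<rightarrow>\<^bsub>G\<^esub> y"
  shows "0 < out_degree G x"
proof -
  have "finite {z. x \<rightarrow>\<^bsub>G\<^esub> z}"
    using out_neighbours_verts finite_verts by (rule finite_subset)
  then show ?thesis
    using assms card_gt_0_iff[of "{z. x \<rightarrow>\<^bsub>G\<^esub> z}"] by (auto simp: card_out_neighbours)
qed

text \<open>The quotient on the right is the mean of \<open>f\<close> over the neighbours of
  \<open>x\<close>; all later estimates are phrased in such means.\<close>

lemma (in digraph) sum_lazy_walk:
  assumes "x \<in> verts G"
  shows "(\<Sum>z\<in>verts G. f z * lazy_walk G p x z)
    = p * f x + (1 - p) * ((\<Sum>z | x \<rightarrow>\<^bsub>G\<^esub> z. f z) / real (out_degree G x))"
proof -
  \<comment> \<open>Without a loop at \<open>x\<close> the idle mass and the neighbour mass sit on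
    disjoint sets, so the nested conditionals become a sum of two.\<close>
  have nx: "\<not> x \<rightarrow>\<^bsub>G\<^esub> x"
    using no_loops by (auto simp: arcs_ends_conv)
  have "(\<Sum>z\<in>verts G. f z * lazy_walk G p x z)
    = (\<Sum>z\<in>verts G. (if z = x then p * f x else 0)
        + (if z \<in> {z. x \<rightarrow>\<^bsub>G\<^esub> z} then (1 - p) / real (out_degree G x) * f z else 0))"
    using nx by (intro sum.cong) (auto simp: lazy_walk_def)
  also have "\<dots> = p * f x + (\<Sum>z | x \<rightarrow>\<^bsub>G\<^esub> z. (1 - p) / real (out_degree G x) * f z)"
    using assms
    by (simp only: sum.distrib finite_verts sum.inter_restrict[symmetric]
        Int_absorb1[OF out_neighbours_verts] sum.delta if_True)
  finally show ?thesis
    by (simp add: sum_distrib_left sum_divide_distrib)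
qed

text \<open>The arc gives \<open>x\<close> a positive degree; at an isolated vertex the total mass
  would be only \<open>p\<close>.\<close>

lemma (in digraph) lazy_walk_prob:
  assumes "x \<rightarrow>\<^bsub>G\<^esub> y"
  shows "(\<Sum>z\<in>verts G. lazy_walk G p x z) = 1"
proof -
  have "x \<in> verts G" using assms by (auto simp: arcs_ends_conv)
  from sum_lazy_walk[OF this, of "\<lambda>_. 1" p] show ?thesis
    using out_degree_pos[OF assms] by (simp add: card_out_neighbours)
qed

lemma lazy_walk_nonneg: "0 \<le> p \<Longrightarrow> p \<le> 1 \<Longrightarrow> 0 \<le> lazy_walk G p x z"
  by (simp add: lazy_walk_def)

lemma (in graph) lazy_walk_couplings_nonempty:
  assumes "x \<rightarrow>\<^bsub>G\<^esub> y" "0 \<le> p" "p \<le> 1"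
  shows "couplings G (lazy_walk G p x) (lazy_walk G p y) \<noteq> {}"
proof -
  have "y \<rightarrow>\<^bsub>G\<^esub> x"
    using assms(1) sym_arcs by (auto simp: symmetric_def dest: symD)
  then show ?thesis
    using assms by (intro couplings_nonempty lazy_walk_nonneg lazy_walk_prob)
qed

text \<open>Since \<open>f\<close> grows by exactly 1 along the edge, the idle masses contribute
  exactly \<open>p\<close> to the dual bound, and the factor \<open>1 - p\<close> splits
  off.\<close>

lemma (in graph) ollivier_curvature_le:
  fixes f :: "'a \<Rightarrow> real"
  assumes xy: "x \<rightarrow>\<^bsub>G\<^esub> y" and p: "0 \<le> p" "p \<le> 1"
    and lip: "\<And>u v. u \<in> verts G \<Longrightarrow> v \<in> verts G \<Longrightarrow> f v - f u \<le> gdist G u v"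
    and fxy: "f y = f x + 1"
  shows "ollivier_curvature G p x y
    \<le> (1 - p) * (1 + (\<Sum>z | x \<rightarrow>\<^bsub>G\<^esub> z. f z) / real (out_degree G x)
                  - (\<Sum>z | y \<rightarrow>\<^bsub>G\<^esub> z. f z) / real (out_degree G y))"
proof -
  have "x \<in> verts G" "y \<in> verts G" using xy by (auto simp: arcs_ends_conv)
  then show ?thesis
    using W1_ge_lipschitz[OF lip lazy_walk_couplings_nonempty[OF xy p]]
    by (simp add: ollivier_curvature_def sum_lazy_walk fxy algebra_simps)
qed

section \<open>Dependence of the curvature on the idleness, and the limit\<close>

lemma lazy_walk_mix:
  fixes p q :: real
  assumes "p < 1"
  defines "t \<equiv> (1 - q) / (1 - p)"
  shows "lazy_walk G q x z = t * lazy_walk G p x z + (1 - t) * (if z = x then 1 else 0)"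
proof -
  have "t * (1 - p) = 1 - q" using assms by simp
  moreover from this have "q = t * p + (1 - t)" by (simp add: algebra_simps)
  ultimately show ?thesis
    by (auto simp: lazy_walk_def)
qed

(* The walk with idleness q is a mixture of the walk with idleness p and a point mass, and the
   two point masses are coupled at cost at most 1. *)
lemma (in graph) ollivier_curvature_mono:
  assumes xy: "x \<rightarrow>\<^bsub>G\<^esub> y" and pq: "0 \<le> p" "p \<le> q" "q < 1"
  shows "ollivier_curvature G p x y / (1 - p) \<le> ollivier_curvature G q x y / (1 - q)"
proof -
  define t where "t = (1 - q) / (1 - p)"
  have t: "0 < t" "t \<le> 1" "t * (1 - p) = 1 - q"
    using pq by (auto simp: t_def field_simps)
  let ?V = "verts G"
  have V: "x \<in> ?V" "y \<in> ?V" using xy by (auto simp: arcs_ends_conv)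
  \<comment> \<open>The only coupling of the point masses at \<open>x\<close> and \<open>y\<close>;
    its cost is \<open>gdist G x y\<close>.\<close>
  let ?\<delta> = "\<lambda>u v. (if v = y then if u = x then 1 else 0 else 0) :: real"
  have "(W1 G (lazy_walk G q x) (lazy_walk G q y) - (1 - t)) / t
      \<le> W1 G (lazy_walk G p x) (lazy_walk G p y)"
    unfolding W1_def[of G "lazy_walk G p x"]
  proof (rule cINF_greatest)
    show "couplings G (lazy_walk G p x) (lazy_walk G p y) \<noteq> {}"
      using xy pq by (intro lazy_walk_couplings_nonempty) auto
  next
    fix \<pi> assume \<pi>: "\<pi> \<in> couplings G (lazy_walk G p x) (lazy_walk G p y)"
    let ?C = "\<Sum>u\<in>?V. \<Sum>v\<in>?V. gdist G u v * \<pi> u v"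
    let ?\<pi> = "\<lambda>u v. t * \<pi> u v + (1 - t) * ?\<delta> u v"
    have mix: "lazy_walk G q w z = t * lazy_walk G p w z + (1 - t) * (if z = w then 1 else 0)"
      for w z unfolding t_def using pq by (intro lazy_walk_mix) auto
    have r: "(\<Sum>v\<in>?V. ?\<delta> u v) = (if u = x then 1 else 0)" for u
      using V by simp
    have c: "(\<Sum>u\<in>?V. ?\<delta> u v) = (if v = y then 1 else 0)" for v
      using V by (cases "v = y") auto
    have "?\<pi> \<in> couplings G (lazy_walk G q x) (lazy_walk G q y)"
      using \<pi> t V unfolding couplings_def mix
      by (auto simp: sum.distrib r c simp flip: sum_distrib_left simp del: sum.delta)
    from W1_le[OF this] have "W1 G (lazy_walk G q x) (lazy_walk G q y)
      \<le> (\<Sum>u\<in>?V. \<Sum>v\<in>?V. gdist G u v * ?\<pi> u v)" .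
    also have "\<dots> = (\<Sum>u\<in>?V. \<Sum>v\<in>?V. t * (gdist G u v * \<pi> u v)
        + (1 - t) * (if v = y then if u = x then gdist G x y else 0 else 0))"
      by (intro sum.cong) (auto simp: algebra_simps)
    also have "\<dots> = t * ?C + (1 - t) * gdist G x y"
      using V by (simp add: sum.distrib flip: sum_distrib_left)
    also have "\<dots> \<le> t * ?C + (1 - t) * 1"
      using gdist_le_1[OF xy] t by (intro add_left_mono mult_left_mono) auto
    finally show "(W1 G (lazy_walk G q x) (lazy_walk G q y) - (1 - t)) / t \<le> ?C"
      using t by (simp add: field_simps)
  qed
  \<comment> \<open>Here \<open>1 - (1 - t) = t\<close>, so the estimate for \<open>W1\<close>
    becomes a pure scaling of the curvature by \<open>t\<close>.\<close>
  then have "t * ollivier_curvature G p x y \<le> ollivier_curvature G q x y"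
    using t by (simp add: ollivier_curvature_def field_simps)
  then show ?thesis
    using pq t by (simp add: t_def field_simps)
qed

text \<open>The limit is the supremum over \<open>{a..<b}\<close>. Existence is the point:
  \<open>Lim\<close> has a usable value only once convergence is known.\<close>

lemma tendsto_at_left_mono_bounded:
  fixes g :: "real \<Rightarrow> real"
  assumes ab: "a < b" and mono: "\<And>p q. a \<le> p \<Longrightarrow> p \<le> q \<Longrightarrow> q < b \<Longrightarrow> g p \<le> g q"
    and le: "\<And>p. a \<le> p \<Longrightarrow> p < b \<Longrightarrow> g p \<le> B"
  shows "\<exists>l\<le>B. (g \<longlongrightarrow> l) (at_left b)"
proof (intro exI conjI)
  define l where "l = (SUP p\<in>{a..<b}. g p)"
  have bdd: "bdd_above (g ` {a..<b})"
    using le by (intro bdd_aboveI2[where M = B]) auto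
  show "l \<le> B"
    unfolding l_def using ab le by (intro cSUP_least) auto
  show "(g \<longlongrightarrow> l) (at_left b)"
  proof (rule increasing_tendsto)
    show "\<forall>\<^sub>F p in at_left b. g p \<le> l"
      unfolding eventually_at_left[OF ab] l_def
      using ab by (intro exI[of _ a]) (auto intro!: cSUP_upper bdd)
  next
    fix m assume "m < l"
    then obtain r where r: "r \<in> {a..<b}" "m < g r"
      unfolding l_def using ab bdd by (subst (asm) less_cSUP_iff) auto
    then show "\<forall>\<^sub>F p in at_left b. m < g p"
      unfolding eventually_at_left[OF ab]
      by (intro exI[of _ r]) (auto intro: less_le_trans[OF _ mono])
  qed
qed

text \<open>The quotient increases with \<open>p\<close> and stays below a bound independent of
  \<open>p\<close>; this gives both convergence and the estimate of the limit.\<close>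

lemma (in graph) lly_curvature_le:
  fixes f :: "'a \<Rightarrow> real"
  assumes xy: "x \<rightarrow>\<^bsub>G\<^esub> y"
    and lip: "\<And>u v. u \<in> verts G \<Longrightarrow> v \<in> verts G \<Longrightarrow> f v - f u \<le> gdist G u v"
    and fxy: "f y = f x + 1"
  shows "lly_curvature G x y
    \<le> 1 + (\<Sum>z | x \<rightarrow>\<^bsub>G\<^esub> z. f z) / real (out_degree G x)
        - (\<Sum>z | y \<rightarrow>\<^bsub>G\<^esub> z. f z) / real (out_degree G y)" (is "_ \<le> ?B")
proof -
  have "\<exists>l\<le>?B. ((\<lambda>p. ollivier_curvature G p x y / (1 - p)) \<longlongrightarrow> l) (at_left 1)"
  proof (rule tendsto_at_left_mono_bounded[of 0])
    fix p :: real assume p: "0 \<le> p" "p < 1"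
    then show "ollivier_curvature G p x y / (1 - p) \<le> ?B"
      using ollivier_curvature_le[OF xy _ _ lip fxy, of p]
      by (simp add: divide_le_eq mult.commute)
  qed (auto intro: ollivier_curvature_mono[OF xy])
  then obtain l where "l \<le> ?B"
    "((\<lambda>p. ollivier_curvature G p x y / (1 - p)) \<longlongrightarrow> l) (at_left 1)" by blast
  then show ?thesis
    by (simp add: lly_curvature_def tendsto_Lim)
qed

text \<open>Finitely many arcs make the infimum a lower bound for the curvature of each arc.\<close>

lemma (in fin_digraph) bonnet_myers_sharp_le:
  assumes "bonnet_myers_sharp G" "x \<rightarrow>\<^bsub>G\<^esub> y"
  shows "2 / diam G \<le> lly_curvature G x y"
proof -
  have "finite (arcs_ends G)" by (simp add: arcs_ends_conv)
  then have "(INF (x, y)\<in>arcs_ends G. lly_curvature G x y) \<le> lly_curvature G x y"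
    using assms(2) cINF_lower[of "\<lambda>(x, y). lly_curvature G x y" "arcs_ends G" "(x, y)"] by auto
  then show ?thesis
    using assms(1) by (simp add: bonnet_myers_sharp_def)
qed

section \<open>Antitrees\<close>

lemma verts_antitree: "verts (antitree as) = antitree_verts as"
  by (simp add: antitree_def)

lemma antitree_dominates:
  "u \<rightarrow>\<^bsub>antitree as\<^esub> v \<longleftrightarrow> u \<in> antitree_verts as \<and> v \<in> antitree_verts as \<and> u \<noteq> v \<and>
     (fst u = fst v \<or> fst v = Suc (fst u) \<or> fst u = Suc (fst v))"
  by (auto simp: antitree_def arcs_ends_conv image_iff)

lemma (in wf_digraph) awalk_ConsI_dominates:
  assumes "u \<rightarrow>\<^bsub>G\<^esub> w" "awalk w p v"
  shows "\<exists>q. awalk u q v \<and> length q = Suc (length p)"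
proof -
  obtain e where "e \<in> arcs G" "tail G e = u" "head G e = w"
    using assms(1) by (auto simp: arcs_ends_conv)
  then have "awalk u (e # p) v" using assms(2) by (auto simp: awalk_Cons_iff)
  then show ?thesis by (intro exI[of _ "e # p"]) auto
qed

lemma sum_level:
  fixes g :: "nat \<Rightarrow> real"
  shows "(\<Sum>z\<in>{k} \<times> A. g (fst z)) = real (card A) * g k"
proof -
  have "(\<Sum>z\<in>{k} \<times> A. g (fst z)) = (\<Sum>z\<in>{k} \<times> A. g k)"
    by (intro sum.cong) auto
  then show ?thesis by (simp add: card_cartesian_product)
qed

section \<open>Antitrees with nonempty layers: walks, diameter and mean levels\<close>

context
  fixes as :: "nat list"
  assumes pos: "\<And>k. k < length as \<Longrightarrow> 0 < as ! k"
begin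

interpretation graph "antitree as" by (rule graph_antitree)

text \<open>Consecutive layers are completely joined, so a walk can move one layer per step and end
  at any prescribed vertex. The gap is \<open>n + 1\<close>, and both directions are treated at
  once.\<close>

lemma antitree_awalk_levels:
  assumes "(k, i) \<in> antitree_verts as" "(l, j) \<in> antitree_verts as"
    and "l = Suc (k + n) \<or> k = Suc (l + n)"
  shows "\<exists>p. awalk (k, i) p (l, j) \<and> length p = Suc n"
  using assms
proof (induction n arbitrary: k i)
  case 0
  then have "(k, i) \<rightarrow>\<^bsub>antitree as\<^esub> (l, j)" by (auto simp: antitree_dominates)
  moreover have "awalk (l, j) [] (l, j)"
    using 0 by (simp add: awalk_Nil_iff verts_antitree)
  ultimately show ?case using awalk_ConsI_dominates[of "(k, i)" "(l, j)" "[]"] by simp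
next
  case (Suc n)
  \<comment> \<open>The layer next to \<open>k\<close> in the direction of \<open>l\<close>; its
    vertex with index 0 exists because layers are nonempty.\<close>
  define m where "m = (if k < l then Suc k else k - 1)"
  have l: "l = Suc (m + n) \<or> m = Suc (l + n)" and near: "m = Suc k \<or> k = Suc m"
    using Suc.prems(3) by (auto simp: m_def)
  have "k < length as" "l < length as"
    using Suc.prems(1,2) by (simp_all add: antitree_verts_def)
  then have "m < length as" by (auto simp: m_def)
  then have m: "(m, 0) \<in> antitree_verts as"
    using pos by (simp add: antitree_verts_def)
  then have e: "(k, i) \<rightarrow>\<^bsub>antitree as\<^esub> (m, 0)"
    using Suc.prems(1) near by (auto simp: antitree_dominates)
  obtain p where p: "awalk (m, 0) p (l, j)" "length p = Suc n"
    using Suc.IH[OF m Suc.prems(2) l] by blast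
  show ?case using awalk_ConsI_dominates[OF e p(1)] unfolding p(2) .
qed

text \<open>The maximum with 1 covers two distinct vertices of the same layer when there is only one
  layer.\<close>

lemma antitree_awalk:
  assumes "u \<in> antitree_verts as" "v \<in> antitree_verts as"
  shows "\<exists>p. awalk u p v \<and> length p \<le> max 1 (length as - 1)"
proof -
  obtain k i l j where [simp]: "u = (k, i)" "v = (l, j)" by fastforce
  have len: "k < length as" "l < length as"
    using assms by (auto simp: antitree_verts_def)
  consider "u = v" | "u \<noteq> v" "k = l" | "k < l" | "l < k" by fastforce
  then show ?thesis
  proof cases
    case 1
    then have "awalk u [] v" using assms by (simp add: awalk_Nil_iff verts_antitree)
    then show ?thesis by (intro exI[of _ "[]"]) simp
  next
    case 2
    then have "u \<rightarrow>\<^bsub>antitree as\<^esub> v" using assms by (auto simp: antitree_dominates)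
    moreover have "awalk v [] v" using assms by (simp add: awalk_Nil_iff verts_antitree)
    ultimately have "\<exists>p. awalk u p v \<and> length p = 1"
      using awalk_ConsI_dominates[of u v "[]"] by simp
    then show ?thesis by (metis max.cobounded1)
  next
    case 3
    then obtain n where n: "l = Suc (k + n)" using less_imp_Suc_add by blast
    then obtain p where "awalk (k, i) p (l, j)" "length p = Suc n"
      using antitree_awalk_levels[of k i l j n] assms by auto
    moreover from this have "length p \<le> max 1 (length as - 1)" using n len by linarith
    ultimately show ?thesis by (intro exI[of _ p]) simp
  next
    case 4
    then obtain n where n: "k = Suc (l + n)" using less_imp_Suc_add by blast
    then obtain p where "awalk (k, i) p (l, j)" "length p = Suc n"
      using antitree_awalk_levels[of k i l j n] assms by auto
    moreover from this have "length p \<le> max 1 (length as - 1)" using n len by linarith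
    ultimately show ?thesis by (intro exI[of _ p]) simp
  qed
qed

text \<open>Levels of adjacent vertices differ by at most 1, and the antitree is connected.\<close>

lemma antitree_level_lipschitz:
  assumes "u \<in> antitree_verts as" "v \<in> antitree_verts as"
  shows "real (fst v) - real (fst u) \<le> gdist (antitree as) u v"
proof (rule gdist_lipschitz[where f = "\<lambda>z. real (fst z)"])
  show "u \<rightarrow>\<^sup>*\<^bsub>antitree as\<^esub> v"
    using antitree_awalk[OF assms] by (auto simp: reachable_awalk)
qed (auto simp: antitree_dominates)

text \<open>Explicit walks give the upper bound; the level function forces equality between the
  first and the last layer.\<close>

lemma diam_antitree:
  assumes "2 \<le> length as"
  shows "diam (antitree as) = real (length as - 1)"
  unfolding diam_def
proof (rule Max_eqI)
  show "finite ((\<lambda>(u, v). gdist (antitree as) u v) `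
      (verts (antitree as) \<times> verts (antitree as)))"
    by simp
next
  fix d assume "d \<in> (\<lambda>(u, v). gdist (antitree as) u v) `
      (verts (antitree as) \<times> verts (antitree as))"
  then obtain u v where uv: "u \<in> antitree_verts as" "v \<in> antitree_verts as"
    and d: "d = gdist (antitree as) u v" by (auto simp: verts_antitree)
  then obtain p where "awalk u p v" "length p \<le> max 1 (length as - 1)"
    using antitree_awalk by blast
  then show "d \<le> real (length as - 1)"
    using gdist_le_length[of u p v] assms d by linarith
next
  let ?u = "(0, 0) :: nat \<times> nat" and ?v = "(length as - 1, 0) :: nat \<times> nat"
  have "0 < as ! 0" "0 < as ! (length as - 1)"
    by (rule pos, use assms in linarith)+
  then have uv: "?u \<in> antitree_verts as" "?v \<in> antitree_verts as"
    using assms by (auto simp: antitree_verts_def)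
  have "\<exists>p. awalk ?u p ?v \<and> length p = Suc (length as - 2)"
    using assms by (intro antitree_awalk_levels uv) auto
  then have "gdist (antitree as) ?u ?v \<le> real (length as - 1)"
    using gdist_le_length[of ?u _ ?v] assms by fastforce
  then have "gdist (antitree as) ?u ?v = real (length as - 1)"
    using antitree_level_lipschitz[OF uv] by simp
  then show "real (length as - 1) \<in> (\<lambda>(u, v). gdist (antitree as) u v) `
      (verts (antitree as) \<times> verts (antitree as))"
    using uv by (force simp: verts_antitree image_iff)
qed

lemma antitree_lly_curvature_le:
  assumes "x \<rightarrow>\<^bsub>antitree as\<^esub> y" "fst y = Suc (fst x)"
  shows "lly_curvature (antitree as) x y
    \<le> 1 + (\<Sum>z | x \<rightarrow>\<^bsub>antitree as\<^esub> z. real (fst z)) / real (out_degree (antitree as) x)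
        - (\<Sum>z | y \<rightarrow>\<^bsub>antitree as\<^esub> z. real (fst z)) / real (out_degree (antitree as) y)"
proof (rule lly_curvature_le[OF assms(1)])
  show "real (fst v) - real (fst u) \<le> gdist (antitree as) u v"
    if "u \<in> verts (antitree as)" "v \<in> verts (antitree as)" for u v
    using that antitree_level_lipschitz by (simp add: verts_antitree)
qed (simp add: assms(2))

text \<open>A general \<open>g\<close> serves twice: the constant 1 yields the degree, the identity
  the sum of the levels. The \<open>- 1\<close> removes the vertex itself.\<close>

lemma sum_neighbours_first_level:
  fixes g :: "nat \<Rightarrow> real"
  assumes "i < as ! 0" "1 < length as"
  shows "(\<Sum>z | (0, i) \<rightarrow>\<^bsub>antitree as\<^esub> z. g (fst z))
    = (real (as ! 0) - 1) * g 0 + real (as ! 1) * g 1"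
proof -
  have "{z. (0, i) \<rightarrow>\<^bsub>antitree as\<^esub> z} = {0} \<times> ({..<as ! 0} - {i}) \<union> {1} \<times> {..<as ! 1}"
    using assms by (auto simp: antitree_dominates antitree_verts_def)
  moreover have "(\<Sum>z\<in>{0} \<times> ({..<as ! 0} - {i}) \<union> {1} \<times> {..<as ! 1}. g (fst z))
    = (\<Sum>z\<in>{0} \<times> ({..<as ! 0} - {i}). g (fst z)) + (\<Sum>z\<in>{1} \<times> {..<as ! 1}. g (fst z))"
    by (intro sum.union_disjoint) auto
  ultimately show ?thesis
    using assms by (simp add: sum_level of_nat_diff card_Diff_singleton)
qed

lemma sum_neighbours_inner_level:
  fixes g :: "nat \<Rightarrow> real"
  assumes "i < as ! Suc k" "Suc (Suc k) < length as"
  shows "(\<Sum>z | (Suc k, i) \<rightarrow>\<^bsub>antitree as\<^esub> z. g (fst z))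
    = real (as ! k) * g k + (real (as ! Suc k) - 1) * g (Suc k)
      + real (as ! Suc (Suc k)) * g (Suc (Suc k))"
proof -
  let ?A = "{k} \<times> {..<as ! k}" and ?B = "{Suc k} \<times> ({..<as ! Suc k} - {i})"
    and ?C = "{Suc (Suc k)} \<times> {..<as ! Suc (Suc k)}"
  have "{z. (Suc k, i) \<rightarrow>\<^bsub>antitree as\<^esub> z} = ?A \<union> (?B \<union> ?C)"
    using assms by (auto simp: antitree_dominates antitree_verts_def)
  moreover have "(\<Sum>z\<in>?A \<union> (?B \<union> ?C). g (fst z))
    = (\<Sum>z\<in>?A. g (fst z)) + (\<Sum>z\<in>?B \<union> ?C. g (fst z))"
    by (intro sum.union_disjoint) auto
  moreover have "(\<Sum>z\<in>?B \<union> ?C. g (fst z)) = (\<Sum>z\<in>?B. g (fst z)) + (\<Sum>z\<in>?C. g (fst z))"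
    by (intro sum.union_disjoint) auto
  ultimately show ?thesis
    using assms by (simp add: sum_level of_nat_diff card_Diff_singleton)
qed

lemma out_degree_first_level:
  assumes "i < as ! 0" "1 < length as"
  shows "real (out_degree (antitree as) (0, i)) = real (as ! 0) - 1 + real (as ! 1)"
  using sum_neighbours_first_level[OF assms, of "\<lambda>_. 1"] by (simp add: card_out_neighbours)

lemma out_degree_inner_level:
  assumes "i < as ! Suc k" "Suc (Suc k) < length as"
  shows "real (out_degree (antitree as) (Suc k, i))
    = real (as ! k) + (real (as ! Suc k) - 1) + real (as ! Suc (Suc k))"
  using sum_neighbours_inner_level[OF assms, of "\<lambda>_. 1"] by (simp add: card_out_neighbours)

text \<open>Relative to \<open>Suc k\<close>, the neighbours have levels -1, 0 and 1, so only the
  difference of the two adjacent layer sizes survives in the numerator.\<close>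

lemma mean_level_inner:
  assumes "i < as ! Suc k" "Suc (Suc k) < length as"
  shows "(\<Sum>z | (Suc k, i) \<rightarrow>\<^bsub>antitree as\<^esub> z. real (fst z))
      / real (out_degree (antitree as) (Suc k, i))
    = real (Suc k) + (real (as ! Suc (Suc k)) - real (as ! k))
      / (real (as ! k) + (real (as ! Suc k) - 1) + real (as ! Suc (Suc k)))"
proof -
  have "1 \<le> real (as ! k)" "1 \<le> real (as ! Suc k)" "1 \<le> real (as ! Suc (Suc k))"
    using assms pos[of k] pos[of "Suc k"] pos[of "Suc (Suc k)"] by linarith+
  then have "real (as ! k) + (real (as ! Suc k) - 1) + real (as ! Suc (Suc k)) \<noteq> 0"
    by linarith
  then show ?thesis
    unfolding out_degree_inner_level[OF assms] sum_neighbours_inner_level[OF assms, of real]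
    by (simp add: field_simps)
qed

end

section \<open>The six-layer symmetrical antitrees\<close>

lemma antitree_not_bonnet_myers_sharp:
  fixes b c :: nat
  assumes b: "0 < b" and c: "0 < c"
  shows "\<not> bonnet_myers_sharp (antitree [1, b, c, c, b, 1])"
proof
  let ?as = "[1, b, c, c, b, 1]"
  let ?G = "antitree ?as"
  assume sharp: "bonnet_myers_sharp ?G"
  interpret graph ?G by (rule graph_antitree)
  have pos: "0 < ?as ! k" if "k < length ?as" for k
    using that b c by (auto simp: less_Suc_eq nth_Cons')
  \<comment> \<open>The mean level of the neighbours of a representative of layer
    \<open>k\<close>.\<close>
  define m where "m k = (\<Sum>z | (k, 0) \<rightarrow>\<^bsub>?G\<^esub> z. real (fst z)) / real (out_degree ?G (k, 0))"
    for k :: nat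
  have edge: "2 / 5 \<le> 1 + m k - m (Suc k)" if "k < 5" for k
  proof -
    have "(k, 0) \<in> antitree_verts ?as" "(Suc k, 0) \<in> antitree_verts ?as"
      using that pos[of k] pos[of "Suc k"] by (simp_all add: antitree_verts_def)
    then have e: "(k, 0) \<rightarrow>\<^bsub>?G\<^esub> (Suc k, 0)" by (simp add: antitree_dominates)
    have "2 / diam ?G \<le> lly_curvature ?G (k, 0) (Suc k, 0)"
      by (rule bonnet_myers_sharp_le[OF sharp e])
    also have "\<dots> \<le> 1 + m k - m (Suc k)"
      unfolding m_def by (rule antitree_lly_curvature_le[OF pos e]) auto
    finally show ?thesis using diam_antitree[OF pos] by simp
  qed
  \<comment> \<open>The excess of the mean neighbour level over the own level, in layers 1 and
    2.\<close>
  let ?q1 = "(real c - 1) / (real b + real c)"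
  let ?q2 = "(real c - real b) / (real b + 2 * real c - 1)"
  have bc: "1 \<le> real b" "1 \<le> real c" using b c by auto
  \<comment> \<open>Layer 0 is a single vertex, so all its neighbours lie in layer 1.\<close>
  have m0: "m 0 = 1"
    using b out_degree_first_level[OF pos, of 0] sum_neighbours_first_level[OF pos, of 0 real]
    by (simp add: m_def)
  have m1: "m 1 = 1 + ?q1"
    using b mean_level_inner[OF pos, of 0 0] by (simp add: m_def)
  have m2: "m 2 = 2 + ?q2"
    using c mean_level_inner[OF pos, of 0 1]
    by (simp add: m_def numeral_2_eq_2 algebra_simps)
  have "m 3 = 3 + (real b - real c) / (real b + 2 * real c - 1)"
    using c mean_level_inner[OF pos, of 0 2]
    by (simp add: m_def numeral_2_eq_2 numeral_3_eq_3 algebra_simps)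
  \<comment> \<open>Reflecting the antitree exchanges layers 2 and 3 and reverses the sign of the
    excess.\<close>
  then have m3: "m 3 = 3 - ?q2"
    by (metis diff_minus_eq_add minus_diff_eq minus_divide_left uminus_add_conv_diff add.commute)
  \<comment> \<open>The first two edges give \<open>?q2 \<le> ?q1 - 2 / 5 \<le> 1 / 5\<close>, while
    the middle edge gives \<open>2 / 5 \<le> 2 * ?q2\<close>. Hence equality.\<close>
  have "?q1 \<le> 3 / 5" using edge[of 0] m0 m1 by simp
  moreover have "2 / 5 \<le> ?q1 - ?q2" using edge[of 1] m1 m2 by (simp add: numeral_2_eq_2)
  moreover have "2 / 5 \<le> 1 + m 2 - m 3" using edge[of 2] by simp
  then have "1 / 5 \<le> ?q2" using m2 m3 by linarith
  ultimately have "?q2 = 1 / 5" by linarith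
  then have "3 * real c + 1 = 6 * real b"
    using bc by (simp add: field_simps)
  then have "3 * c + 1 = 6 * b" by linarith
  \<comment> \<open>Modulo 3 the equation reads 1 = 0.\<close>
  then show False by presburger
qed

theorem theorem4p7:
  shows "(\<nexists>as :: nat list. length as = 6 \<and> (\<forall>a\<in>set as. 0 < a) \<and> symmetrical as \<and> as ! 0 = 1 \<and>
            diam (antitree as) = 5 \<and> bonnet_myers_sharp (antitree as))
       \<and> (\<forall>b c :: nat. 0 < b \<longrightarrow> 0 < c \<longrightarrow> \<not> bonnet_myers_sharp (antitree [1, b, c, c, b, 1]))"
proof (intro conjI notI allI impI)
  assume "\<exists>as :: nat list. length as = 6 \<and> (\<forall>a\<in>set as. 0 < a) \<and> symmetrical as \<and> as ! 0 = 1 \<and>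
            diam (antitree as) = 5 \<and> bonnet_myers_sharp (antitree as)"
  then obtain as :: "nat list" where as: "length as = 6" "\<forall>a\<in>set as. 0 < a" "symmetrical as"
    "as ! 0 = 1" "bonnet_myers_sharp (antitree as)" by blast
  have "as ! k = as ! (length as - 1 - k)" if "k < 6" for k
    using as(3) that unfolding symmetrical_def as(1) by blast
  \<comment> \<open>With indices from 0 the reflection is \<open>k\<close> to \<open>5 - k\<close>,
    so the last three entries are determined by the first three.\<close>
  from this[of 3] this[of 4] this[of 5]
  have sym: "as ! 3 = as ! 2" "as ! 4 = as ! 1" "as ! 5 = 1"
    by (simp_all add: as(1,4))
  have "as = [as ! 0, as ! 1, as ! 2, as ! 3, as ! 4, as ! 5]"
    using as(1) by (auto simp: length_Suc_conv numeral_eq_Suc)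
  also have "\<dots> = [1, as ! 1, as ! 2, as ! 2, as ! 1, 1]"
    by (simp only: sym as(4))
  finally have "bonnet_myers_sharp (antitree [1, as ! 1, as ! 2, as ! 2, as ! 1, 1])"
    using as(5) by (rule subst)
  moreover have "0 < as ! 1" "0 < as ! 2"
    using as(1,2) by simp_all
  ultimately show False
    using antitree_not_bonnet_myers_sharp by blast
next
  fix b c :: nat assume "0 < b" "0 < c" "bonnet_myers_sharp (antitree [1, b, c, c, b, 1])"
  then show False using antitree_not_bonnet_myers_sharp by blast
qed

end
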